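(* Let $G=(V,E)$ be a $3$-connected graph and $C\subseteq G$ a non-interleaved cycle. Then $\sum_{e\in E(C)}x_e\le 2$ defines a facet of $\textsc{Bond}(G)$.
   Context: For a connected graph $G=(V,E)$ and $S\subseteq V$, the cut $\delta(S)=\{e\in E:|e\cap S|=1\}$ is a bond if $G[S]$ and $G[V\setminus S]$ are both connected. The incidence vector $x^\delta\in\mathbb{R}^E$ has $x^\delta_e=1$ iff $e\in\delta$. $\textsc{Bond}(G)=\mathrm{conv}\{x^\delta:\delta\text{ a bond}\}$. A cycle $C\subseteq G$ is interleaved if there are vertices $v_1,v_2,v_3,v_4\in V(C)$ occurring along $C$ in this order and vertex-disjoint paths in $G-E(C)$ connecting $v_1$ with $v_3$ and $v_2$ with $v_4$, respectively; otherwise it is non-interleaved. Graphs are simple. *)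

theory Defs
  imports "HOL-Analysis.Analysis"
begin

text \<open>Finiteness of the graph comes from the vertex type.\<close>

definition simple_graph :: "'v::finite set \<Rightarrow> 'v set set \<Rightarrow> bool" where
  "simple_graph V E \<longleftrightarrow> (\<forall>e\<in>E. e \<subseteq> V \<and> card e = 2)"

definition graph_path :: "'v set \<Rightarrow> 'v set set \<Rightarrow> 'v list \<Rightarrow> bool" where
  "graph_path V E p \<longleftrightarrow>
     p \<noteq> [] \<and> distinct p \<and> set p \<subseteq> V \<and> successively (\<lambda>u v. {u, v} \<in> E) p"

definition graph_path_between :: "'v set \<Rightarrow> 'v set set \<Rightarrow> 'v \<Rightarrow> 'v list \<Rightarrow> 'v \<Rightarrow> bool" where
  "graph_path_between V E u p v \<longleftrightarrow> graph_path V E p \<and> hd p = u \<and> last p = v"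

text \<open>The empty graph counts as connected, so the empty cut of a connected graph is a bond.\<close>

definition graph_connected :: "'v set \<Rightarrow> 'v set set \<Rightarrow> bool" where
  "graph_connected V E \<longleftrightarrow> (\<forall>u\<in>V. \<forall>v\<in>V. \<exists>p. graph_path_between V E u p v)"

definition induced_edges :: "'v set set \<Rightarrow> 'v set \<Rightarrow> 'v set set" where
  "induced_edges E S = {e \<in> E. e \<subseteq> S}"

definition k_connected :: "nat \<Rightarrow> 'v set \<Rightarrow> 'v set set \<Rightarrow> bool" where
  "k_connected k V E \<longleftrightarrow>
     card V > k \<and>
     (\<forall>X\<subseteq>V. card X < k \<longrightarrow> graph_connected (V - X) (induced_edges E (V - X)))"

definition cut :: "'v set set \<Rightarrow> 'v set \<Rightarrow> 'v set set" where
  "cut E S = {e \<in> E. card (e \<inter> S) = 1}"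

definition is_bond :: "'v set \<Rightarrow> 'v set set \<Rightarrow> 'v set set \<Rightarrow> bool" where
  "is_bond V E d \<longleftrightarrow>
     (\<exists>S\<subseteq>V. d = cut E S \<and>
        graph_connected S (induced_edges E S) \<and>
        graph_connected (V - S) (induced_edges E (V - S)))"

text \<open>The space \<open>\<real>\<^sup>E\<close> is realised as the coordinate subspace of \<open>real ^ 'v set\<close> of the vectors
  that vanish outside \<open>E\<close>: every bond is a subset of \<open>E\<close>, so its incidence vector lies there.\<close>

definition incidence_vector :: "'v::finite set set \<Rightarrow> real ^ 'v set" where
  "incidence_vector d = (\<chi> e. if e \<in> d then 1 else 0)"

definition bond_polytope :: "'v::finite set \<Rightarrow> 'v set set \<Rightarrow> (real ^ 'v set) set" where
  "bond_polytope V E = convex hull {incidence_vector d | d. is_bond V E d}"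

text \<open>A cycle is given by the list of its vertices in cyclic order.\<close>

definition cycle_edges :: "'v list \<Rightarrow> 'v set set" where
  "cycle_edges c = {{c ! i, c ! (Suc i mod length c)} | i. i < length c}"

definition is_cycle :: "'v set \<Rightarrow> 'v set set \<Rightarrow> 'v list \<Rightarrow> bool" where
  "is_cycle V E c \<longleftrightarrow>
     length c \<ge> 3 \<and> distinct c \<and> set c \<subseteq> V \<and> cycle_edges c \<subseteq> E"

text \<open>The condition on the four vertices is invariant under cyclic shifts of
  \<open>(v\<^sub>1, v\<^sub>2, v\<^sub>3, v\<^sub>4)\<close>, so it does not matter at which vertex the list starts.\<close>

definition interleaved :: "'v set \<Rightarrow> 'v set set \<Rightarrow> 'v list \<Rightarrow> bool" where
  "interleaved V E c \<longleftrightarrow>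
     (\<exists>i\<^sub>1 i\<^sub>2 i\<^sub>3 i\<^sub>4 p q.
        i\<^sub>1 < i\<^sub>2 \<and> i\<^sub>2 < i\<^sub>3 \<and> i\<^sub>3 < i\<^sub>4 \<and> i\<^sub>4 < length c \<and>
        graph_path_between V (E - cycle_edges c) (c ! i\<^sub>1) p (c ! i\<^sub>3) \<and>
        graph_path_between V (E - cycle_edges c) (c ! i\<^sub>2) q (c ! i\<^sub>4) \<and>
        set p \<inter> set q = {})"

definition defines_facet ::
    "('a::euclidean_space \<Rightarrow> real) \<Rightarrow> real \<Rightarrow> 'a set \<Rightarrow> bool" where
  "defines_facet l b P \<longleftrightarrow>
     linear l \<and> (\<forall>x\<in>P. l x \<le> b) \<and> {x \<in> P. l x = b} facet_of P"

end

theory Submission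
  imports Defs
begin

text \<open>If a bond had more than two edges on \<open>C\<close>, shortest connections inside its two sides would
  interleave \<open>C\<close>. So every bond has at most two edges on \<open>C\<close>, and exactly two as soon as both sides
  meet \<open>C\<close>. For the dimension, let \<open>y \<in> \<real>\<^sup>E\<close> be orthogonal to all these tight bonds; we need
  \<open>y = 0\<close>. Tight bonds are supplied by sweeping \<open>G\<close>, or \<open>G - v\<close>, from \<open>t \<in> C\<close> to \<open>s \<in> C\<close> one vertex
  at a time with both sides connected, as in an st-numbering; this only needs 2-connectedness.
  When \<open>w\<close> passes from one side to the other, the total weights of \<open>y\<close> from \<open>w\<close> to the two sides
  agree. These balance equations kill first the edges with one end on \<open>C\<close>, then those disjoint
  from \<open>C\<close>, and finally the edges of \<open>C\<close>, which has no chords.\<close>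

section \<open>Connectedness without paths\<close>

text \<open>A path-free form of connectedness of the subgraph induced on \<open>W\<close>: adjoining
  a vertex and finding an edge that leaves a set then need no handling of paths.\<close>

definition crossing_connected :: "'v set set \<Rightarrow> 'v set \<Rightarrow> bool" where
  "crossing_connected E W \<longleftrightarrow>
     (\<forall>A\<subseteq>W. A \<noteq> {} \<longrightarrow> A \<noteq> W \<longrightarrow> (\<exists>a\<in>A. \<exists>b\<in>W - A. {a, b} \<in> E))"

lemma crossing_connectedE:
  assumes "crossing_connected E W" "A \<subseteq> W" "x \<in> A" "y \<in> W" "y \<notin> A"
  obtains a b where "a \<in> A" "b \<in> W - A" "{a, b} \<in> E"
  using assms unfolding crossing_connected_def by blast

lemma successively_crossing:
  assumes "successively R p" "p \<noteq> []" "hd p \<in> A" "last p \<notin> A"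
  obtains a b where "a \<in> A" "a \<in> set p" "b \<notin> A" "b \<in> set p" "R a b"
  using assms
proof (induction p arbitrary: thesis)
  case Nil
  then show ?case by simp
next
  case (Cons x p)
  show ?case
  proof (cases p)
    case Nil
    with Cons.prems show ?thesis by auto
  next
    case (Cons z q)
    show ?thesis
    proof (cases "z \<in> A")
      case True
      then show ?thesis
        using Cons Cons.IH Cons.prems
        by (metis hd_Cons_tl last.simps list.discI list.sel(1) list.set_intros(2)
            successively.simps(3))
    next
      case False
      then show ?thesis
        using Cons Cons.prems by (auto)
    qed
  qed
qed

text \<open>A path that leaves a set uses an edge leaving it. Conversely, if the set reachable from
  \<open>u\<close> were proper, an edge leaving it would extend some path.\<close>

lemma graph_connected_iff_crossing_connected:
  "graph_connected W (induced_edges E W) \<longleftrightarrow> crossing_connected E W"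
proof
  assume L: "graph_connected W (induced_edges E W)"
  show "crossing_connected E W"
    unfolding crossing_connected_def
  proof (intro allI impI)
    fix A assume A: "A \<subseteq> W" "A \<noteq> {}" "A \<noteq> W"
    then obtain u v where uv: "u \<in> A" "v \<in> W" "v \<notin> A" by blast
    then obtain p where "graph_path_between W (induced_edges E W) u p v"
      using L A unfolding graph_connected_def by blast
    then have p: "p \<noteq> []" "set p \<subseteq> W" "successively (\<lambda>u v. {u, v} \<in> induced_edges E W) p"
      "hd p \<in> A" "last p \<notin> A"
      using uv unfolding graph_path_between_def graph_path_def by auto
    obtain a b where "a \<in> A" "a \<in> set p" "b \<notin> A" "b \<in> set p" "{a, b} \<in> induced_edges E W"
      using successively_crossing[OF p(3) p(1) p(4) p(5)] .
    then show "\<exists>a\<in>A. \<exists>b\<in>W - A. {a, b} \<in> E"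
      using p(2) unfolding induced_edges_def by blast
  qed
next
  assume R: "crossing_connected E W"
  show "graph_connected W (induced_edges E W)"
    unfolding graph_connected_def
  proof (intro ballI, rule ccontr)
    fix u v assume uv: "u \<in> W" "v \<in> W"
      and no: "\<nexists>p. graph_path_between W (induced_edges E W) u p v"
    define A where "A = {x. \<exists>p. graph_path_between W (induced_edges E W) u p x}"
    have "u \<in> A"
      unfolding A_def using uv
      by (auto simp: graph_path_between_def graph_path_def intro!: exI[of _ "[u]"])
    moreover have "A \<subseteq> W"
      unfolding A_def graph_path_between_def graph_path_def by auto
    moreover have "v \<notin> A" using no unfolding A_def by blast
    ultimately obtain a b where ab: "a \<in> A" "b \<in> W - A" "{a, b} \<in> E"
      using R uv by (elim crossing_connectedE[of E W A u v]) auto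
    then obtain p where p: "p \<noteq> []" "distinct p" "set p \<subseteq> W"
      "successively (\<lambda>u v. {u, v} \<in> induced_edges E W) p" "hd p = u" "last p = a"
      unfolding A_def graph_path_between_def graph_path_def by blast
    \<comment> \<open>Paths must be \<open>distinct\<close>; one already through \<open>b\<close>
      could be cut off there and would reach \<open>b\<close>.\<close>
    have "b \<notin> set p"
    proof
      assume "b \<in> set p"
      then obtain q r where qr: "p = q @ b # r" by (meson split_list)
      then have "graph_path_between W (induced_edges E W) u (q @ [b]) b"
        using p successively_append_iff[of _ "q @ [b]" r]
        unfolding graph_path_between_def graph_path_def by (cases q) auto
      then show False using ab unfolding A_def by blast
    qed
    moreover have "{a, b} \<in> induced_edges E W"
      using ab \<open>A \<subseteq> W\<close> unfolding induced_edges_def by auto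
    ultimately have "graph_path_between W (induced_edges E W) u (p @ [b]) b"
      using p ab unfolding graph_path_between_def graph_path_def
      by (auto simp: successively_append_iff)
    then show False using ab unfolding A_def by blast
  qed
qed

lemma crossing_connected_singleton [simp]: "crossing_connected E {x}"
  unfolding crossing_connected_def by blast

lemma crossing_connected_empty [simp]: "crossing_connected E {}"
  unfolding crossing_connected_def by blast

lemma crossing_connected_insert:
  assumes "crossing_connected E W" "x \<in> W" "{x, y} \<in> E"
  shows "crossing_connected E (insert y W)"
  unfolding crossing_connected_def
proof (intro allI impI)
  fix A assume A: "A \<subseteq> insert y W" "A \<noteq> {}" "A \<noteq> insert y W"
  show "\<exists>a\<in>A. \<exists>b\<in>insert y W - A. {a, b} \<in> E"
  proof (cases "A \<inter> W = {} \<or> W \<subseteq> A")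
    case True
    then show ?thesis
    proof
      assume "A \<inter> W = {}"
      then have "A = {y}" "y \<notin> W" using A by auto
      then show ?thesis using assms(2,3) by (auto simp: insert_commute)
    next
      assume "W \<subseteq> A"
      then show ?thesis using A assms(2,3) by blast
    qed
  next
    case False
    then have "A \<inter> W \<subseteq> W" "A \<inter> W \<noteq> {}" "A \<inter> W \<noteq> W" by auto
    then show ?thesis
      using assms(1) unfolding crossing_connected_def by blast
  qed
qed

section \<open>Sweeping a 2-connected graph vertex by vertex\<close>

text \<open>One step of an st-numbering of a 2-connected graph: among the pairs of a vertex \<open>w\<close> that may
  be moved and a connected set \<open>B \<ni> s\<close> avoiding it, a pair with \<open>B\<close> of maximal size leaves nothing
  outside \<open>B\<close>.\<close>

lemma sweep_step:
  fixes W :: "'v::finite set"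
  assumes conn_del: "\<And>w. w \<in> W \<Longrightarrow> crossing_connected E (W - {w})"
    and "T \<subseteq> W" "t \<in> T" "s \<in> W - T"
    and z: "z \<in> W - T" "z \<noteq> s"
    and conn: "crossing_connected E T" "crossing_connected E (W - T)"
  obtains w where "w \<in> W - T" "w \<noteq> s" "crossing_connected E (insert w T)"
    "crossing_connected E (W - insert w T)"
proof -
  define S where "S = W - T"
  define good where "good = (\<lambda>(w, B). w \<in> S \<and> w \<noteq> s \<and> (\<exists>x\<in>T. {x, w} \<in> E) \<and>
     B \<subseteq> S - {w} \<and> s \<in> B \<and> crossing_connected E B)"
  have "T \<subseteq> W - {s}" "z \<in> W - {s}" "z \<notin> T" using assms(2-5) z by auto
  \<comment> \<open>\<open>z\<close> makes \<open>T\<close> a proper part of the connected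
    \<open>W - {s}\<close>, so \<open>T\<close> has a neighbour \<open>b\<close> other than
    \<open>s\<close>.\<close>
  then obtain a b where "a \<in> T" "b \<in> W - {s} - T" "{a, b} \<in> E"
    using crossing_connectedE[OF conn_del, of s T t z] assms(3,4) by blast
  then have "good (b, {s})"
    using assms(4) unfolding good_def S_def by auto
  then obtain m where m: "good m" "\<And>m'. good m' \<Longrightarrow> card (snd m') \<le> card (snd m)"
    using ex_has_greatest_nat[of good "(b, {s})" "\<lambda>m. card (snd m)" "Suc (card (UNIV :: 'v set))"]
    by (metis card_mono finite le_imp_less_Suc top_greatest)
  obtain w B where wB: "m = (w, B)" by (cases m)
  have good: "w \<in> S" "w \<noteq> s" "\<exists>x\<in>T. {x, w} \<in> E" "B \<subseteq> S - {w}" "s \<in> B" "crossing_connected E B"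
    using m(1) unfolding wB good_def by auto
  have maxi: "\<not> good (w', insert d B)" if "d \<notin> B" for w' d
    using m(2)[of "(w', insert d B)"] that by (auto simp: wB)
  have "B = S - {w}"
  proof (rule ccontr)
    assume "B \<noteq> S - {w}"
    define D where "D = S - {w} - B"
    then obtain d where d: "d \<in> D" using good \<open>B \<noteq> S - {w}\<close> by auto
    \<comment> \<open>An edge from \<open>B\<close> to \<open>y\<close> in \<open>D\<close> would
      let \<open>B\<close> absorb \<open>y\<close> while \<open>w\<close> stays.\<close>
    have no: "{x, y} \<notin> E" if "x \<in> B" "y \<in> D" for x y
      using maxi[of y w] that good crossing_connected_insert[OF good(6) that(1), of y]
      unfolding good_def D_def by auto
    \<comment> \<open>\<open>W - {w}\<close> is connected and \<open>D\<close> has no edge to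
      \<open>B\<close>, so some \<open>w'\<close> in \<open>D\<close> touches \<open>T\<close>. As
      \<open>S\<close> is connected, \<open>B\<close> has an edge leaving it, which can only end in
      \<open>w\<close>. Hence \<open>w'\<close> with \<open>insert w B\<close> is a larger
      pair.\<close>
    obtain w' y where w': "w' \<in> D" "y \<in> W - {w} - D" "{w', y} \<in> E"
      using crossing_connectedE[of E "W - {w}" D d t] conn_del[of w] d assms(2,3) good(1)
      unfolding D_def S_def by auto
    then have "y \<in> T"
      using no[of y w'] by (auto simp: D_def S_def insert_commute)
    obtain x v where x: "x \<in> B" "v \<in> S - B" "{x, v} \<in> E"
      using crossing_connectedE[of E S B s w] conn(2) good unfolding S_def by blast
    then have "v = w" using no unfolding D_def by blast
    then have "crossing_connected E (insert w B)"
      using crossing_connected_insert good(6) x by metis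
    moreover have "insert w B \<subseteq> S - {w'}" using good w'(1) unfolding D_def by auto
    ultimately have "good (w', insert w B)"
      using good w' \<open>y \<in> T\<close> unfolding good_def D_def by (auto simp: insert_commute)
    then show False using maxi[of w] good(4) by blast
  qed
  moreover have "W - insert w T = S - {w}" unfolding S_def by auto
  ultimately show thesis
    using that[of w] good crossing_connected_insert[OF conn(1)] unfolding S_def by auto
qed

text \<open>Take \<open>T\<close> largest among the admissible sides that avoid \<open>Z\<close>. A
  vertex of \<open>Z\<close> still lies on the other side, so one more step is possible, and by
  maximality it moves a vertex of \<open>Z\<close>.\<close>

lemma sweep:
  fixes W :: "'v::finite set"
  assumes conn_del: "\<And>w. w \<in> W \<Longrightarrow> crossing_connected E (W - {w})"
    and st: "s \<in> W" "t \<in> W" "s \<noteq> t"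
    and Z: "Z \<subseteq> W - {s, t}" "Z \<noteq> {}"
  obtains T w where "T \<subseteq> W" "t \<in> T" "s \<notin> T" "T \<inter> Z = {}" "w \<in> Z"
    "crossing_connected E T" "crossing_connected E (W - T)"
    "crossing_connected E (insert w T)" "crossing_connected E (W - insert w T)"
proof -
  define good where "good T \<longleftrightarrow> T \<subseteq> W \<and> t \<in> T \<and> s \<notin> T \<and> T \<inter> Z = {} \<and>
    crossing_connected E T \<and> crossing_connected E (W - T)" for T
  have "good {t}" using conn_del st Z unfolding good_def by auto
  then obtain T where T: "good T" "\<And>T'. good T' \<Longrightarrow> card T' \<le> card T"
    using ex_has_greatest_nat[of good "{t}" card "Suc (card (UNIV :: 'v set))"]
    by (metis card_mono finite le_imp_less_Suc top_greatest)
  obtain z where z: "z \<in> Z" using Z by auto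
  obtain w where w: "w \<in> W - T" "w \<noteq> s" "crossing_connected E (insert w T)"
    "crossing_connected E (W - insert w T)"
    using sweep_step[OF conn_del, of T t s z] T(1) z Z st unfolding good_def by blast
  have "w \<in> Z"
  proof (rule ccontr)
    assume "w \<notin> Z"
    then have "good (insert w T)" using T(1) w unfolding good_def by auto
    from T(2)[OF this] show False using w(1) by auto
  qed
  then show thesis using that[of T w] w T(1) unfolding good_def by blast
qed

section \<open>Paths inside the two sides of a bond\<close>

lemma cycle_edge_mem: "i < length C \<Longrightarrow> {C ! i, C ! (Suc i mod length C)} \<in> cycle_edges C"
  unfolding cycle_edges_def by auto

lemma graph_path_between_rev:
  assumes "graph_path_between V E u p v"
  shows "graph_path_between V E v (rev p) u"
  using assms unfolding graph_path_between_def graph_path_def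
  by (auto simp: hd_rev last_rev insert_commute)

text \<open>A cycle edge joins cyclically consecutive positions, so it cannot jump over
  \<open>k\<close> or \<open>l\<close>.\<close>

lemma cycle_edge_not_separated:
  assumes "distinct C" "{C ! a, C ! b} \<in> cycle_edges C" "a < length C" "b < length C"
    and "k < a" "a < l" "l < length C" "b < k \<or> l < b"
  shows False
proof -
  obtain i where i: "i < length C" "{C ! a, C ! b} = {C ! i, C ! (Suc i mod length C)}"
    using assms(2) unfolding cycle_edges_def by auto
  have m: "Suc i mod length C < length C" using i by (auto intro: mod_less_divisor)
  have "(a = i \<and> b = Suc i mod length C) \<or> (b = i \<and> a = Suc i mod length C)"
    using i m assms(1,3,4) by (auto simp: doubleton_eq_iff nth_eq_iff_index_eq)
  moreover have "Suc i mod length C = (if Suc i = length C then 0 else Suc i)"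
    using i by auto
  ultimately show False using assms by (auto split: if_splits)
qed

text \<open>A shortest path in \<open>U\<close> between the two sides of \<open>C\<close> determined by \<open>k\<close> and \<open>l\<close> has no inner
  vertex on \<open>C\<close>, and its end vertices are not adjacent on \<open>C\<close>.\<close>

lemma path_across_separated_pair:
  assumes "distinct C" "U \<subseteq> V" and U: "graph_connected U (induced_edges E U)"
    and kl: "k < l" "l < length C" "C ! k \<notin> U" "C ! l \<notin> U"
    and a: "k < a" "a < l" "C ! a \<in> U" and b: "b < length C" "b < k \<or> l < b" "C ! b \<in> U"
  obtains a' b' p where "k < a'" "a' < l" "b' < length C" "b' < k \<or> l < b'" "set p \<subseteq> U"
    "graph_path_between V (E - cycle_edges C) (C ! a') p (C ! b')"
proof -
  define I where "I = (!) C ` {k<..<l}"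
  define Ou where "Ou = (!) C ` {i. i < length C \<and> (i < k \<or> l < i)}"
  define P where "P p \<longleftrightarrow> graph_path U (induced_edges E U) p \<and> hd p \<in> I \<and> last p \<in> Ou" for p
  have "\<exists>p. P p"
    using U a b unfolding graph_connected_def P_def graph_path_between_def I_def Ou_def by force
  then obtain p where p: "P p" "\<And>q. P q \<Longrightarrow> length p \<le> length q"
    using ex_has_least_nat[of P _ length] by blast
  have gp: "p \<noteq> []" "distinct p" "set p \<subseteq> U" "successively (\<lambda>u v. {u, v} \<in> induced_edges E U) p"
    "hd p \<in> I" "last p \<in> Ou"
    using p(1) unfolding P_def graph_path_def by auto
  have split: "x \<in> I \<or> x \<in> Ou" if "x \<in> U" "x \<in> set C" for x
  proof -
    obtain i where "i < length C" "x = C ! i" using \<open>x \<in> set C\<close> by (metis in_set_conv_nth)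
    moreover have "i \<noteq> k" "i \<noteq> l" using calculation that kl by auto
    ultimately show ?thesis unfolding I_def Ou_def by force
  qed
  \<comment> \<open>Otherwise the rest of \<open>p\<close> from that vertex on would be a shorter
    path of the same kind; \<open>notO\<close> cuts off the end instead.\<close>
  have notI: "p ! Suc m \<notin> I" if "Suc m < length p" for m
  proof
    assume "p ! Suc m \<in> I"
    have "P (drop (Suc m) p)"
      using gp that \<open>p ! Suc m \<in> I\<close> set_drop_subset[of "Suc m" p]
        successively_append_iff[of _ "take (Suc m) p" "drop (Suc m) p"]
      unfolding P_def graph_path_def by (auto simp: hd_drop_conv_nth)
    from p(2)[OF this] that show False by auto
  qed
  have notO: "p ! m \<notin> Ou" if "Suc m < length p" for m
  proof
    assume "p ! m \<in> Ou"
    have "P (take (Suc m) p)"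
      using gp that \<open>p ! m \<in> Ou\<close> set_take_subset[of "Suc m" p]
        successively_append_iff[of _ "take (Suc m) p" "drop (Suc m) p"]
      unfolding P_def graph_path_def by (auto simp: last_conv_nth)
    from p(2)[OF this] that show False by auto
  qed
  have "successively (\<lambda>u v. {u, v} \<in> E - cycle_edges C) p"
    unfolding successively_conv_nth
  proof (intro allI impI)
    fix m assume m: "Suc m < length p"
    have e: "{p ! m, p ! Suc m} \<in> induced_edges E U"
      using gp(4) m unfolding successively_conv_nth by blast
    \<comment> \<open>Both ends of such an edge would lie on \<open>C\<close>, so by
      \<open>notI\<close> and \<open>notO\<close> it would lead from \<open>I\<close> straight to
      \<open>Ou\<close>, over \<open>k\<close> or \<open>l\<close>.\<close>
    have "{p ! m, p ! Suc m} \<notin> cycle_edges C"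
    proof
      assume ce: "{p ! m, p ! Suc m} \<in> cycle_edges C"
      then obtain i where "i < length C" "{p ! m, p ! Suc m} = {C ! i, C ! (Suc i mod length C)}"
        unfolding cycle_edges_def by blast
      moreover then have "Suc i mod length C < length C" by (intro mod_less_divisor) auto
      ultimately have "{p ! m, p ! Suc m} \<subseteq> set C" by simp
      moreover have "p ! m \<in> U" "p ! Suc m \<in> U" using m gp(3) by auto
      ultimately have "p ! m \<in> I" "p ! Suc m \<in> Ou"
        using split notI[OF m] notO[OF m] by auto
      then obtain i j where "p ! m = C ! i" "p ! Suc m = C ! j" "k < i" "i < l" "j < length C"
          "j < k \<or> l < j"
        unfolding I_def Ou_def by auto
      then show False
        using cycle_edge_not_separated[of C i j k l] ce assms(1) kl by auto
    qed
    with e show "{p ! m, p ! Suc m} \<in> E - cycle_edges C" unfolding induced_edges_def by auto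
  qed
  moreover obtain a' b' where "hd p = C ! a'" "last p = C ! b'" "k < a'" "a' < l" "b' < length C"
      "b' < k \<or> l < b'"
    using gp(5,6) unfolding I_def Ou_def by auto
  ultimately show thesis
    using that[of a' b' p] gp assms(2) unfolding graph_path_between_def graph_path_def by auto
qed

text \<open>A path in \<open>U\<close> across the pair at positions \<open>i\<^sub>2\<close>,
  \<open>i\<^sub>4\<close> may end at vertices other than the given ones, but its ends again
  separate that pair on \<open>C\<close>. So a path in \<open>V - U\<close> across these ends
  exists, and it is disjoint from the first.\<close>

lemma interleaved_if_alternating:
  assumes "distinct C" "U \<subseteq> V"
    and U: "graph_connected U (induced_edges E U)"
    and U': "graph_connected (V - U) (induced_edges E (V - U))"
    and i: "i\<^sub>1 < i\<^sub>2" "i\<^sub>2 < i\<^sub>3" "i\<^sub>3 < i\<^sub>4" "i\<^sub>4 < length C"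
    and C: "C ! i\<^sub>1 \<in> U" "C ! i\<^sub>2 \<in> V - U" "C ! i\<^sub>3 \<in> U" "C ! i\<^sub>4 \<in> V - U"
  shows "interleaved V E C"
proof -
  let ?E = "E - cycle_edges C"
  obtain a b p where ab: "i\<^sub>2 < a" "a < i\<^sub>4" "b < length C" "b < i\<^sub>2 \<or> i\<^sub>4 < b" "set p \<subseteq> U"
    and p: "graph_path_between V ?E (C ! a) p (C ! b)"
    using path_across_separated_pair[OF assms(1,2) U, of i\<^sub>2 i\<^sub>4 i\<^sub>3 i\<^sub>1] i C by auto
  have ab': "C ! a \<in> U" "C ! b \<in> U"
    using p ab(5) hd_in_set[of p] last_in_set[of p]
    unfolding graph_path_between_def graph_path_def by auto
  \<comment> \<open>\<open>lo\<close> and \<open>hi\<close> are the ends of the first path in list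
    order, \<open>j\<close> and \<open>m\<close> the positions in \<open>V - U\<close> that they
    separate.\<close>
  have main: "interleaved V E C"
    if p: "graph_path_between V ?E (C ! lo) p (C ! hi)" "set p \<subseteq> U"
      and lh: "lo < hi" "hi < length C" "C ! lo \<in> U" "C ! hi \<in> U"
      and j: "lo < j" "j < hi" "C ! j \<in> V - U"
      and m: "m < length C" "m < lo \<or> hi < m" "C ! m \<in> V - U" for lo hi j m p
  proof -
    obtain c d q where cd: "lo < c" "c < hi" "d < length C" "d < lo \<or> hi < d" "set q \<subseteq> V - U"
      and q: "graph_path_between V ?E (C ! c) q (C ! d)"
      using path_across_separated_pair[OF assms(1) _ U', of V lo hi j m] lh j m by auto
    have dis: "set p \<inter> set q = {}" "set (rev q) \<inter> set p = {}" using p(2) cd(5) by auto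
    from cd(4) show ?thesis
    proof
      assume "hi < d"
      then show ?thesis using p(1) q dis(1) cd lh unfolding interleaved_def by blast
    next
      \<comment> \<open>The order is now \<open>d\<close>, \<open>lo\<close>, \<open>c\<close>,
        \<open>hi\<close>, so the reversed \<open>q\<close> becomes the path between the first and
        third positions.\<close>
      assume "d < lo"
      then show ?thesis
        using p(1) graph_path_between_rev[OF q] dis(2) cd lh unfolding interleaved_def by blast
    qed
  qed
  from ab(4) show ?thesis
  proof
    assume "b < i\<^sub>2"
    then show ?thesis
      using main[OF graph_path_between_rev[OF p], of i\<^sub>2 i\<^sub>4] ab ab' i C by auto
  next
    assume "i\<^sub>4 < b"
    then show ?thesis
      using main[OF p, of i\<^sub>4 i\<^sub>2] ab ab' i C by auto
  qed
qed

section \<open>Changes along a cyclic 0/1 sequence\<close>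

text \<open>A cyclic sequence changes an even number of times, so a third change forces a fourth.
  Only the last change can wrap around, hence the single \<open>mod\<close>.\<close>

lemma alternating_if_three_changes:
  fixes f :: "nat \<Rightarrow> bool"
  assumes "i < j" "j < k" "k < n"
    and "f i \<noteq> f (Suc i)" "f j \<noteq> f (Suc j)" "f k \<noteq> f (Suc k mod n)"
  obtains a b c d where "a < b" "b < c" "c < d" "d < n" "f a \<noteq> f b" "f b \<noteq> f c" "f c \<noteq> f d"
proof (cases "f (Suc i) = f j")
  case False
  then have "Suc i < j" using assms by (metis Suc_lessI)
  then show thesis using that[of i "Suc i" j "Suc j"] False assms by auto
next
  case ij: True
  show thesis
  proof (cases "f (Suc j) = f k")
    case False
    then have "Suc j < k" using assms by (metis Suc_lessI)
    then show thesis using that[of i j "Suc j" k] False ij assms by auto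
  next
    case jk: True
    show thesis
    proof (cases "Suc k = n")
      case True
      \<comment> \<open>At the wrap-around, \<open>f 0\<close> agrees with \<open>f j\<close> and so
        differs from \<open>f i\<close>; position 0 comes first in the alternation.\<close>
      then have "f k \<noteq> f 0" using assms by auto
      then have "0 < i" using ij jk assms by (cases i) auto
      then show thesis using that[of 0 i j k] True ij jk assms by auto
    next
      case False
      then show thesis using that[of i j k "Suc k"] ij jk assms by auto
    qed
  qed
qed

lemma card_changes_le_2:
  fixes f :: "nat \<Rightarrow> bool"
  assumes "\<And>a b c d. a < b \<Longrightarrow> b < c \<Longrightarrow> c < d \<Longrightarrow> d < n \<Longrightarrow> f a \<noteq> f b \<Longrightarrow> f b \<noteq> f c \<Longrightarrow>
    f c \<noteq> f d \<Longrightarrow> False"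
  shows "card {i. i < n \<and> f i \<noteq> f (Suc i mod n)} \<le> 2"
proof (rule ccontr)
  let ?J = "{i. i < n \<and> f i \<noteq> f (Suc i mod n)}"
  assume "\<not> card ?J \<le> 2"
  then have "3 \<le> card ?J" by simp
  then obtain A where A: "A \<subseteq> ?J" "card A = 3" "finite A"
    by (rule obtain_subset_with_card_n)
  have "length (sorted_list_of_set A) = 3" using A by simp
  then obtain i j k where ijk: "sorted_list_of_set A = [i, j, k]"
    by (metis length_0_conv length_Suc_conv numeral_3_eq_3)
  have "sorted_wrt (<) [i, j, k]" by (metis ijk strict_sorted_list_of_set)
  then have lt: "i < j" "j < k" by auto
  have "A = {i, j, k}"
    using arg_cong[OF ijk, of set] A(3) by simp
  then have J: "i \<in> ?J" "j \<in> ?J" "k \<in> ?J" using A by auto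
  then have "Suc i mod n = Suc i" "Suc j mod n = Suc j" using lt by auto
  then show False
    using alternating_if_three_changes[OF lt, of n f] assms J by auto
qed

text \<open>Positions \<open>a\<close> and \<open>b\<close> split the cyclic sequence into two arcs,
  and each arc contains a change.\<close>

lemma card_changes_ge_2:
  fixes f :: "nat \<Rightarrow> bool"
  assumes "a < n" "b < n" "f a \<noteq> f b"
  shows "card {i. i < n \<and> f i \<noteq> f (Suc i mod n)} \<ge> 2"
proof -
  let ?J = "{i. i < n \<and> f i \<noteq> f (Suc i mod n)}"
  have *: "2 \<le> card ?J" if ab: "a < b" "b < n" "f a \<noteq> f b" for a b
  proof -
    have const: "f i = f j" if "i \<le> j" "\<And>m. i \<le> m \<Longrightarrow> m < j \<Longrightarrow> f m = f (Suc m)" for i j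
      using that by (induction j rule: dec_induct) auto
    obtain m where m: "a \<le> m" "m < b" "f m \<noteq> f (Suc m)"
      using const[of a b] ab by auto
    \<comment> \<open>The second arc runs from \<open>b\<close> to \<open>n - 1\<close>, wraps to 0
      and ends at \<open>a\<close>.\<close>
    have "\<exists>m'\<in>?J. m' < a \<or> b \<le> m'"
    proof (rule ccontr)
      assume "\<not> (\<exists>m'\<in>?J. m' < a \<or> b \<le> m')"
      then have c: "f m = f (Suc m mod n)" if "m < n" "m < a \<or> b \<le> m" for m
        using that by blast
      have "f m = f (Suc m)" if "b \<le> m" "m < n - 1" for m
        using c[of m] that by auto
      then have "f b = f (n - 1)"
        using const[of b "n - 1"] ab by auto
      moreover have "b \<le> n - 1" using ab by auto
      then have "f (n - 1) = f 0" using c[of "n - 1"] ab by auto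
      moreover have "f m = f (Suc m)" if "m < a" for m
        using c[of m] that ab by auto
      then have "f 0 = f a" using const[of 0 a] by auto
      ultimately show False using ab by simp
    qed
    then obtain m' where m': "m' \<in> ?J" "m' < a \<or> b \<le> m'" by blast
    have "m \<in> ?J" using m ab by auto
    moreover have "m \<noteq> m'" using m m' by auto
    ultimately have "card {m, m'} \<le> card ?J" using m' by (intro card_mono) auto
    then show ?thesis using \<open>m \<noteq> m'\<close> by simp
  qed
  show ?thesis using *[of a b] *[of b a] assms by (cases a b rule: linorder_cases) auto
qed

section \<open>Number of edges of a bond on the cycle\<close>

text \<open>Distinct indices giving the same edge would be each other's successors, which forces the
  length to divide 2.\<close>

lemma cycle_edges_inj:
  assumes "distinct C" "length C \<ge> 3"
  shows "inj_on (\<lambda>i. {C ! i, C ! (Suc i mod length C)}) {..<length C}"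
proof (rule inj_onI)
  fix i j assume ij: "i \<in> {..<length C}" "j \<in> {..<length C}"
    "{C ! i, C ! (Suc i mod length C)} = {C ! j, C ! (Suc j mod length C)}"
  have "Suc i mod length C < length C" "Suc j mod length C < length C"
    using ij by (auto intro!: mod_less_divisor)
  then have "i = j \<or> (i = Suc j mod length C \<and> j = Suc i mod length C)"
    using ij assms by (auto simp: doubleton_eq_iff nth_eq_iff_index_eq)
  then show "i = j" using ij assms(2)
    by (auto simp: mod_Suc split: if_splits)
qed

lemma card_doubleton_Int_eq_1:
  "x \<noteq> y \<Longrightarrow> card ({x, y} \<inter> S) = 1 \<longleftrightarrow> (x \<in> S) \<noteq> (y \<in> S)"
  by (cases "x \<in> S"; cases "y \<in> S") auto

lemma card_cut_cycle:
  assumes "is_cycle V E C"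
  shows "card (cut E S \<inter> cycle_edges C) =
    card {i. i < length C \<and> (C ! i \<in> S) \<noteq> (C ! (Suc i mod length C) \<in> S)}"
proof -
  have C: "distinct C" "length C \<ge> 3" "cycle_edges C \<subseteq> E"
    using assms unfolding is_cycle_def by auto
  let ?e = "\<lambda>i. {C ! i, C ! (Suc i mod length C)}"
  have ne: "C ! i \<noteq> C ! (Suc i mod length C)" if "i < length C" for i
  proof -
    have "Suc i mod length C < length C" using that by (intro mod_less_divisor) auto
    moreover have "i \<noteq> Suc i mod length C" using that C(2) by (auto simp: mod_Suc)
    ultimately show ?thesis using C(1) that by (simp add: nth_eq_iff_index_eq)
  qed
  have "cut E S \<inter> cycle_edges C =
      ?e ` {i. i < length C \<and> (C ! i \<in> S) \<noteq> (C ! (Suc i mod length C) \<in> S)}" (is "_ = ?e ` ?J")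
    using C(3) card_doubleton_Int_eq_1[OF ne] unfolding cut_def cycle_edges_def by blast
  then show ?thesis
    using card_image[OF inj_on_subset[OF cycle_edges_inj[OF C(1,2)], of ?J]] by auto
qed

text \<open>More than two changes of side along \<open>C\<close> would give four alternating
  vertices; \<open>interleaved_if_alternating\<close> then applies to the side containing the first
  of them.\<close>

lemma card_bond_cycle_le_2:
  assumes "is_cycle V E C" "\<not> interleaved V E C" "is_bond V E d"
  shows "card (d \<inter> cycle_edges C) \<le> 2"
proof -
  obtain S where S: "S \<subseteq> V" "d = cut E S" "graph_connected S (induced_edges E S)"
    "graph_connected (V - S) (induced_edges E (V - S))"
    using assms(3) unfolding is_bond_def by blast
  have C: "distinct C" "set C \<subseteq> V" using assms(1) unfolding is_cycle_def by auto
  have mem: "C ! i \<in> V" if "i < length C" for i using C(2) that by auto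
  have "V - (V - S) = S" using S by auto
  show ?thesis
    unfolding S(2) card_cut_cycle[OF assms(1)]
  proof (rule card_changes_le_2)
    fix a b c d assume *: "a < b" "b < c" "c < d" "d < length C"
      and ne: "(C ! a \<in> S) \<noteq> (C ! b \<in> S)" "(C ! b \<in> S) \<noteq> (C ! c \<in> S)" "(C ! c \<in> S) \<noteq> (C ! d \<in> S)"
    show False
    proof (cases "C ! a \<in> S")
      case True
      then show False
        using interleaved_if_alternating[OF C(1) S(1,3,4), of a b c d] * ne mem assms(2) by auto
    next
      case False
      then show False
        using interleaved_if_alternating[OF C(1) _ S(4), of V a b c d] * ne mem assms(2) S(3)
          \<open>V - (V - S) = S\<close> by auto
    qed
  qed
qed

text \<open>The source of tight bonds: it is enough to see a cycle vertex on either side.\<close>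

lemma card_bond_cycle_eq_2:
  assumes "is_cycle V E C" "\<not> interleaved V E C" "is_bond V E (cut E S)"
    and "x \<in> set C" "x \<in> S" "y \<in> set C" "y \<notin> S"
  shows "card (cut E S \<inter> cycle_edges C) = 2"
proof (rule antisym)
  show "2 \<le> card (cut E S \<inter> cycle_edges C)"
  proof -
    obtain i j where "i < length C" "x = C ! i" "j < length C" "y = C ! j"
      using assms(4,6) by (auto simp: in_set_conv_nth)
    then show ?thesis
      using card_changes_ge_2[of i "length C" j "\<lambda>i. C ! i \<in> S"] assms(5,7)
      unfolding card_cut_cycle[OF assms(1)] by simp
  qed
qed (rule card_bond_cycle_le_2[OF assms(1-3)])

lemma cycle_neighbours:
  assumes "is_cycle V E C" "u \<in> set C"
  obtains s t where "s \<in> set C" "t \<in> set C" "s \<noteq> t" "s \<noteq> u" "t \<noteq> u"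
    "{u, s} \<in> cycle_edges C" "{u, t} \<in> cycle_edges C"
    "\<And>x. {u, x} \<in> cycle_edges C \<Longrightarrow> x = s \<or> x = t"
proof -
  let ?n = "length C"
  have C: "distinct C" "?n \<ge> 3" using assms(1) unfolding is_cycle_def by auto
  obtain j where j: "j < ?n" "u = C ! j" using assms(2) by (auto simp: in_set_conv_nth)
  define i where "i = (if j = 0 then ?n - 1 else j - 1)"
  define k where "k = Suc j mod ?n"
  have i: "i < ?n" "Suc i mod ?n = j" using j C(2) unfolding i_def by auto
  have k: "k < ?n" "k \<noteq> j" "k \<noteq> i" using j C(2) unfolding k_def i_def by (auto simp: mod_Suc)
  have "i \<noteq> j" using j C(2) unfolding i_def by auto
  show thesis
  proof (rule that[of "C ! k" "C ! i"])
    show "{u, C ! k} \<in> cycle_edges C" using cycle_edge_mem[OF j(1)] j(2) unfolding k_def by simp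
    show "{u, C ! i} \<in> cycle_edges C"
      using cycle_edge_mem[OF i(1)] i(2) j(2) by (simp add: insert_commute)
    fix x assume "{u, x} \<in> cycle_edges C"
    then obtain m where m: "m < ?n" "{u, x} = {C ! m, C ! (Suc m mod ?n)}"
      unfolding cycle_edges_def by blast
    have m': "Suc m mod ?n < ?n" using m by (intro mod_less_divisor) auto
    from m(2) have "(u = C ! m \<and> x = C ! (Suc m mod ?n)) \<or> (u = C ! (Suc m mod ?n) \<and> x = C ! m)"
      by (auto simp: doubleton_eq_iff)
    then show "x = C ! k \<or> x = C ! i"
    proof
      assume *: "u = C ! m \<and> x = C ! (Suc m mod ?n)"
      then have "m = j" using m j C(1) by (simp add: nth_eq_iff_index_eq)
      then show ?thesis using * unfolding k_def by simp
    next
      assume *: "u = C ! (Suc m mod ?n) \<and> x = C ! m"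
      then have "Suc m mod ?n = j" using m' j C(1) by (simp add: nth_eq_iff_index_eq)
      then have "m = i" using m unfolding i_def by (auto simp: mod_Suc split: if_splits)
      then show ?thesis using * by simp
    qed
  qed (use C(1) i k j \<open>i \<noteq> j\<close> in \<open>auto simp: nth_eq_iff_index_eq\<close>)
qed

section \<open>Weights orthogonal to all tight bonds vanish\<close>

text \<open>\<open>g a b\<close> stands for the coordinate at the edge \<open>{a, b}\<close> of a
  vector orthogonal to the tight bonds. Written on pairs of vertices, the weight of a cut is a
  double sum over its sides.\<close>

locale tight_weight =
  fixes V :: "'v::finite set" and E :: "'v set set" and C :: "'v list"
    and g :: "'v \<Rightarrow> 'v \<Rightarrow> real"
  assumes conn3: "\<And>X. X \<subseteq> V \<Longrightarrow> card X < 3 \<Longrightarrow> crossing_connected E (V - X)"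
    and cycle: "is_cycle V E C"
    and chordless: "\<And>a b. {a, b} \<in> E \<Longrightarrow> a \<in> set C \<Longrightarrow> b \<in> set C \<Longrightarrow> {a, b} \<in> cycle_edges C"
    and g_sym: "\<And>a b. g a b = g b a"
    and g_zero: "\<And>a b. {a, b} \<notin> E \<Longrightarrow> g a b = 0"
    and edge_ends: "\<And>a b. {a, b} \<in> E \<Longrightarrow> a \<in> V \<and> b \<in> V \<and> a \<noteq> b"
    and tight: "\<And>T s t. T \<subseteq> V \<Longrightarrow> crossing_connected E T \<Longrightarrow> crossing_connected E (V - T) \<Longrightarrow>
      t \<in> set C \<Longrightarrow> t \<in> T \<Longrightarrow> s \<in> set C \<Longrightarrow> s \<notin> T \<Longrightarrow> (\<Sum>a\<in>T. \<Sum>b\<in>V - T. g a b) = 0"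
begin

lemma C_subset: "set C \<subseteq> V" and C_edges: "cycle_edges C \<subseteq> E"
  using cycle unfolding is_cycle_def by auto

lemma g_self [simp]: "g a a = 0"
  using g_zero[of a a] edge_ends[of a a] by auto

lemma conn_del1: "w \<in> V \<Longrightarrow> crossing_connected E (V - {w})"
  using conn3[of "{w}"] by simp

text \<open>This lets \<open>G - v\<close> itself be swept.\<close>

lemma conn_del2: "v \<in> V \<Longrightarrow> w \<in> V - {v} \<Longrightarrow> crossing_connected E (V - {v} - {w})"
  using conn3[of "{v, w}"] card_insert_le_m1[of 2 "{w}" v]
  by (simp add: Diff_insert2[symmetric] insert_commute)

text \<open>The cuts of \<open>T\<close> and \<open>insert w T\<close> contain the same edges away
  from \<open>w\<close>; subtracting the two tight equations leaves only weights at
  \<open>w\<close>.\<close>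

lemma vertex_balance:
  assumes "T \<subseteq> V" "w \<in> V - T"
    and "crossing_connected E T" "crossing_connected E (V - T)"
    and "crossing_connected E (insert w T)" "crossing_connected E (V - insert w T)"
    and "t \<in> set C" "t \<in> T" "s \<in> set C" "s \<notin> insert w T"
  shows "(\<Sum>b\<in>V - insert w T. g w b) = (\<Sum>a\<in>T. g w a)"
proof -
  let ?S = "V - insert w T"
  have S: "V - T = insert w ?S" "w \<notin> ?S" using assms(2) by auto
  have "0 = (\<Sum>a\<in>T. \<Sum>b\<in>V - T. g a b)"
    using tight[of T t s] assms by auto
  also have "\<dots> = (\<Sum>a\<in>T. g w a) + (\<Sum>a\<in>T. \<Sum>b\<in>?S. g a b)"
    unfolding S(1) using S(2) by (simp add: sum.distrib g_sym[of w])
  finally have 1: "0 = (\<Sum>a\<in>T. g w a) + (\<Sum>a\<in>T. \<Sum>b\<in>?S. g a b)" .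
  have "0 = (\<Sum>a\<in>insert w T. \<Sum>b\<in>?S. g a b)"
    using tight[of "insert w T" t s] assms by auto
  also have "\<dots> = (\<Sum>b\<in>?S. g w b) + (\<Sum>a\<in>T. \<Sum>b\<in>?S. g a b)"
    using assms(2) by simp
  finally show ?thesis using 1 by simp
qed

text \<open>Sweeping \<open>G - u\<close> from one cycle neighbour of \<open>u\<close> to the other until \<open>v\<close> is met makes
  \<open>T\<close>, \<open>T + u\<close>, \<open>T + v\<close> and \<open>T + u + v\<close> all sides of tight bonds.\<close>

lemma weight_cycle_to_outside:
  assumes u: "u \<in> set C" and v: "v \<notin> set C"
  shows "g v u = 0"
proof (cases "v \<in> V")
  case False
  then show ?thesis using g_zero edge_ends by blast
next
  case True
  obtain s t where st: "s \<in> set C" "t \<in> set C" "s \<noteq> t" "s \<noteq> u" "t \<noteq> u"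
    "{u, s} \<in> cycle_edges C" "{u, t} \<in> cycle_edges C"
    using cycle_neighbours[OF cycle u] by metis
  then have e: "{s, u} \<in> E" "{t, u} \<in> E" using C_edges by (auto simp: insert_commute)
  have uV: "u \<in> V" using u C_subset by auto
  have "s \<in> V - {u}" "t \<in> V - {u}" "{v} \<subseteq> V - {u} - {s, t}"
    using st C_subset True u v by auto
  then obtain T where T: "T \<subseteq> V - {u}" "t \<in> T" "s \<notin> T" "v \<notin> T"
    "crossing_connected E T" "crossing_connected E (V - {u} - T)"
    "crossing_connected E (insert v T)" "crossing_connected E (V - {u} - insert v T)"
    using sweep[OF conn_del2[OF uV], of s t "{v}"] st(3)
    by (metis disjoint_insert(2) empty_not_insert insert_absorb insert_not_empty singletonD)
  have uv: "u \<noteq> v" "s \<noteq> v" using u v st by auto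
  have s: "s \<in> V - {u} - T" "s \<in> V - {u} - insert v T" using st C_subset T uv by auto
  have [simp]: "V - T = insert u (V - {u} - T)" "V - insert v T = insert u (V - {u} - insert v T)"
    using uV T uv by auto
  have eqs: "V - insert u T = V - {u} - T" "V - insert v (insert u T) = V - {u} - insert v T"
    by auto
  \<comment> \<open>\<open>u\<close> is adjacent to both \<open>s\<close> and \<open>t\<close>, so
    it can join either side without destroying connectedness.\<close>
  have c: "crossing_connected E (V - T)" "crossing_connected E (V - insert v T)"
    using crossing_connected_insert[OF T(6) s(1) e(1)] crossing_connected_insert[OF T(8) s(2) e(1)]
    by auto
  have c': "crossing_connected E (insert u T)" "crossing_connected E (insert v (insert u T))"
    using crossing_connected_insert[OF T(5,2) e(2)] crossing_connected_insert[OF T(7) _ e(2)] T(2)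
    by (auto simp: insert_commute)
  \<comment> \<open>Balance at \<open>v\<close> with \<open>u\<close> on the side of
    \<open>s\<close>, and then on the side of \<open>t\<close>: the term \<open>g v u\<close>
    changes sides, so it equals its own negative.\<close>
  have "(\<Sum>b\<in>V - insert v T. g v b) = (\<Sum>a\<in>T. g v a)"
    by (rule vertex_balance[OF _ _ T(5) c(1) T(7) c(2) st(2) T(2) st(1)])
      (use T True uv in auto)
  then have 1: "g v u + (\<Sum>b\<in>V - {u} - insert v T. g v b) = (\<Sum>a\<in>T. g v a)"
    by simp
  have "(\<Sum>b\<in>V - insert v (insert u T). g v b) = (\<Sum>a\<in>insert u T. g v a)"
    by (rule vertex_balance[OF _ _ c'(1) _ c'(2) _ st(2) _ st(1)])
      (use T True uv uV st in \<open>auto simp: eqs\<close>)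
  moreover have "u \<notin> T" using T by auto
  ultimately have "(\<Sum>b\<in>V - {u} - insert v T. g v b) = g v u + (\<Sum>a\<in>T. g v a)"
    unfolding eqs by simp
  with 1 show ?thesis by simp
qed

text \<open>If \<open>G - v\<close> splits into two connected parts, each meeting \<open>C\<close>,
  then \<open>v\<close> has total weight zero towards each part. Sweeping \<open>G - v\<close> up to
  \<open>x\<close> gives two such splits that differ by \<open>x\<close> alone.\<close>

lemma weight_outside_degree_zero:
  assumes v: "v \<in> V" "v \<notin> set C" and deg: "(\<Sum>x\<in>V. g v x) = 0"
  shows "g v x = 0"
proof (cases "x \<in> V \<and> x \<noteq> v \<and> x \<notin> set C")
  case False
  then show ?thesis
    using weight_cycle_to_outside[of x v] v g_zero edge_ends by (metis g_self)
next
  case True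
  obtain s t where st: "s \<in> set C" "t \<in> set C" "s \<noteq> t"
    using cycle_neighbours[OF cycle] cycle unfolding is_cycle_def
    by (metis length_greater_0_conv less_le_trans nth_mem zero_less_numeral)
  have half: "(\<Sum>a\<in>R. g v a) = 0"
    if R: "R \<subseteq> V - {v}" "t \<in> R" "s \<notin> R" "crossing_connected E R"
      "crossing_connected E (V - {v} - R)" for R
  proof -
    let ?Q = "V - {v} - R"
    have "V = insert v (R \<union> ?Q)" using R v by auto
    then have "(\<Sum>x\<in>V. g v x) = (\<Sum>x\<in>insert v (R \<union> ?Q). g v x)" by simp
    also have "\<dots> = (\<Sum>x\<in>R. g v x) + (\<Sum>x\<in>?Q. g v x)"
      using R sum.union_disjoint[of R ?Q "g v"] by (subst sum.insert) auto
    finally have sum0: "(\<Sum>x\<in>R. g v x) + (\<Sum>x\<in>?Q. g v x) = 0" using deg by simp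
    \<comment> \<open>Balance needs \<open>v\<close> to have a neighbour on each side. Otherwise one
      side carries no weight from \<open>v\<close>, and degree zero settles the other.\<close>
    consider "\<forall>a\<in>R. {v, a} \<notin> E" | "\<forall>a\<in>?Q. {v, a} \<notin> E"
      | a b where "a \<in> R" "{v, a} \<in> E" "b \<in> ?Q" "{v, b} \<in> E" by blast
    then show ?thesis
    proof cases
      case 1
      then show ?thesis using g_zero by (simp add: sum.neutral)
    next
      case 2
      then have "(\<Sum>x\<in>?Q. g v x) = 0" using g_zero by (simp add: sum.neutral)
      then show ?thesis using sum0 by simp
    next
      case 3
      have eqs: "V - R = insert v ?Q" "V - insert v R = ?Q" using R v by auto
      have "crossing_connected E (insert v R)" "crossing_connected E (insert v ?Q)"
        using crossing_connected_insert[OF R(4) 3(1)] crossing_connected_insert[OF R(5) 3(3)] 3(2,4)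
        by (auto simp: insert_commute)
      then have "(\<Sum>b\<in>V - insert v R. g v b) = (\<Sum>a\<in>R. g v a)"
        using R st v by (intro vertex_balance[of R v t s]) (auto simp: eqs)
      then show ?thesis using sum0 eqs by simp
    qed
  qed
  have "s \<in> V - {v}" "t \<in> V - {v}" "{x} \<subseteq> V - {v} - {s, t}"
    using st C_subset True v by auto
  then obtain T where T: "T \<subseteq> V - {v}" "t \<in> T" "s \<notin> T" "x \<notin> T"
    "crossing_connected E T" "crossing_connected E (V - {v} - T)"
    "crossing_connected E (insert x T)" "crossing_connected E (V - {v} - insert x T)"
    using sweep[OF conn_del2[OF v(1)], of s t "{x}"] st(3)
    by (metis disjoint_insert(2) empty_not_insert insert_absorb insert_not_empty singletonD)
  have "(\<Sum>a\<in>T. g v a) = 0" "(\<Sum>a\<in>insert x T. g v a) = 0"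
    using half[of T] half[of "insert x T"] T True st by auto
  then show ?thesis using T(4) by simp
qed

text \<open>Sweep \<open>G\<close> until the first vertex \<open>w\<close> of nonzero degree is met: it has no weight towards the
  part already swept, hence, the bonds before and after \<open>w\<close> being tight, degree zero.\<close>

lemma weight_outside:
  assumes v: "v \<notin> set C"
  shows "g v x = 0"
proof (cases "v \<in> V")
  case False
  then show ?thesis using g_zero edge_ends by blast
next
  case True
  define Z where "Z = {v \<in> V - set C. (\<Sum>x\<in>V. g v x) \<noteq> 0}"
  have "Z = {}"
  proof (rule ccontr)
    assume "Z \<noteq> {}"
    obtain s t where st: "s \<in> set C" "t \<in> set C" "s \<noteq> t"
      using cycle_neighbours[OF cycle] cycle unfolding is_cycle_def
      by (metis length_greater_0_conv less_le_trans nth_mem zero_less_numeral)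
    have "s \<in> V" "t \<in> V" "Z \<subseteq> V - {s, t}" using st C_subset unfolding Z_def by auto
    then obtain T w where T: "T \<subseteq> V" "t \<in> T" "s \<notin> T" "T \<inter> Z = {}" "w \<in> Z"
      "crossing_connected E T" "crossing_connected E (V - T)"
      "crossing_connected E (insert w T)" "crossing_connected E (V - insert w T)"
      using sweep[OF conn_del1, of s t Z] st(3) \<open>Z \<noteq> {}\<close> by metis
    have w: "w \<in> V" "w \<notin> set C" "w \<notin> T" "(\<Sum>x\<in>V. g w x) \<noteq> 0" using T unfolding Z_def by auto
    \<comment> \<open>Off the cycle, \<open>a\<close> has degree zero because \<open>T\<close>
      avoids \<open>Z\<close>, so symmetry of \<open>g\<close> applies.\<close>
    have "g w a = 0" if "a \<in> T" for a
    proof (cases "a \<in> set C")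
      case True
      then show ?thesis using weight_cycle_to_outside w by auto
    next
      case False
      then have "(\<Sum>x\<in>V. g a x) = 0" using that T unfolding Z_def by auto
      then show ?thesis
        using weight_outside_degree_zero[of a w] False that T g_sym[of a w] by auto
    qed
    then have z: "(\<Sum>a\<in>T. g w a) = 0" by simp
    have "(\<Sum>b\<in>V - insert w T. g w b) = (\<Sum>a\<in>T. g w a)"
      using T w st by (intro vertex_balance[of T w t s]) auto
    moreover have "(\<Sum>x\<in>V. g w x) = (\<Sum>x\<in>insert w T. g w x) + (\<Sum>x\<in>V - insert w T. g w x)"
      using w T by (metis Int_insert_right Int_lower1 add.commute finite insert_subset sum.subset_diff)
    ultimately show False using z w T by simp
  qed
  then show ?thesis using weight_outside_degree_zero[of v x] True v unfolding Z_def by blast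
qed

text \<open>Only the two cycle edges at \<open>u\<close> can still carry weight. Sweeping from
  \<open>t\<close> to \<open>s\<close> until \<open>u\<close> is met shows that their weights are
  equal, and the tight bond around \<open>{u}\<close> shows that they sum to zero.\<close>

lemma weight_zero: "g u x = 0"
proof (cases "u \<in> set C \<and> x \<in> set C \<and> {u, x} \<in> E")
  case False
  then show ?thesis using weight_outside g_sym g_zero by metis
next
  case True
  then have u: "u \<in> set C" and ux: "{u, x} \<in> cycle_edges C" using chordless by auto
  have uV: "u \<in> V" using u C_subset by auto
  obtain s t where st: "s \<in> set C" "t \<in> set C" "s \<noteq> t" "s \<noteq> u" "t \<noteq> u"
    and only: "\<And>x. {u, x} \<in> cycle_edges C \<Longrightarrow> x = s \<or> x = t"
    using cycle_neighbours[OF cycle u] by metis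
  have other: "g u y = 0" if "y \<noteq> s" "y \<noteq> t" for y
    using that only[of y] chordless[of u y] u g_zero weight_outside[of y u] g_sym[of u y] by metis
  have sum: "(\<Sum>y\<in>A. g u y) = (if s \<in> A then g u s else 0) + (if t \<in> A then g u t else 0)" for A
  proof -
    have "(\<Sum>y\<in>A. g u y) = (\<Sum>y\<in>A \<inter> {s, t}. g u y)"
      by (rule sum.mono_neutral_right) (auto simp: other)
    also have "\<dots> = (if s \<in> A then g u s else 0) + (if t \<in> A then g u t else 0)"
      using st(3) by (cases "s \<in> A"; cases "t \<in> A") auto
    finally show ?thesis .
  qed
  have "s \<in> V" "t \<in> V" "{u} \<subseteq> V - {s, t}" using st uV C_subset by auto
  then obtain T where T: "T \<subseteq> V" "t \<in> T" "s \<notin> T" "u \<notin> T"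
    "crossing_connected E T" "crossing_connected E (V - T)"
    "crossing_connected E (insert u T)" "crossing_connected E (V - insert u T)"
    using sweep[OF conn_del1, of s t "{u}"] st(3)
    by (metis disjoint_insert(2) empty_not_insert insert_absorb insert_not_empty singletonD)
  have "(\<Sum>b\<in>V - insert u T. g u b) = (\<Sum>a\<in>T. g u a)"
    using T uV st by (intro vertex_balance[of T u t s]) auto
  then have "g u s = g u t"
    unfolding sum using T st \<open>s \<in> V\<close> by auto
  moreover have "(\<Sum>a\<in>{u}. \<Sum>b\<in>V - {u}. g a b) = 0"
    using tight[of "{u}" u s] uV conn_del1 u st by auto
  then have "g u s + g u t = 0" unfolding sum using st \<open>s \<in> V\<close> \<open>t \<in> V\<close> by (auto simp: sum)
  ultimately show ?thesis using other[of x] only[OF ux] by auto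
qed

end

section \<open>From weights back to vectors\<close>

lemma is_bond_cut:
  assumes "S \<subseteq> V" "crossing_connected E S" "crossing_connected E (V - S)"
  shows "is_bond V E (cut E S)"
  using assms unfolding is_bond_def graph_connected_iff_crossing_connected by blast

text \<open>Each cut edge is counted once, from its end in \<open>S\<close>; pairs across the cut
  that are not edges contribute zero.\<close>

lemma sum_cut:
  fixes f :: "'v::finite set \<Rightarrow> real"
  assumes "simple_graph V E" "S \<subseteq> V" "\<And>e. e \<notin> E \<Longrightarrow> f e = 0"
  shows "(\<Sum>e\<in>cut E S. f e) = (\<Sum>a\<in>S. \<Sum>b\<in>V - S. f {a, b})"
proof -
  let ?D = "(\<lambda>(a, b). {a, b}) ` (S \<times> (V - S))"
  have inj: "inj_on (\<lambda>(a, b). {a, b}) (S \<times> (V - S))"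
    by (auto simp: inj_on_def doubleton_eq_iff)
  have sub: "cut E S \<subseteq> ?D"
  proof
    fix e assume e: "e \<in> cut E S"
    then have "e \<in> E" "card (e \<inter> S) = 1" unfolding cut_def by auto
    then obtain x y where xy: "e = {x, y}" "x \<noteq> y" "x \<in> V" "y \<in> V"
      using assms(1) unfolding simple_graph_def card_2_iff by fastforce
    then have "(x \<in> S) \<noteq> (y \<in> S)"
      using card_doubleton_Int_eq_1[of x y S] \<open>card (e \<inter> S) = 1\<close> by auto
    then have "e = (\<lambda>(a, b). {a, b}) (x, y) \<and> (x, y) \<in> S \<times> (V - S) \<or>
        e = (\<lambda>(a, b). {a, b}) (y, x) \<and> (y, x) \<in> S \<times> (V - S)"
      using xy by auto
    then show "e \<in> ?D" by blast
  qed
  have "?D - cut E S \<subseteq> - E"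
  proof
    fix e assume "e \<in> ?D - cut E S"
    then obtain a b where "e = {a, b}" "a \<in> S" "b \<notin> S" "e \<notin> cut E S" by auto
    moreover from this have "card (e \<inter> S) = 1"
      using card_doubleton_Int_eq_1[of a b S] by auto
    ultimately show "e \<in> - E" unfolding cut_def by auto
  qed
  then have "(\<Sum>e\<in>cut E S. f e) = (\<Sum>e\<in>?D. f e)"
    using sub assms(3) by (intro sum.mono_neutral_left) auto
  also have "\<dots> = (\<Sum>(a, b)\<in>S \<times> (V - S). f {a, b})"
    using sum.reindex[OF inj, of f] by (simp add: case_prod_unfold comp_def)
  also have "\<dots> = (\<Sum>a\<in>S. \<Sum>b\<in>V - S. f {a, b})"
    by (simp add: sum.cartesian_product)
  finally show ?thesis .
qed

lemma inner_incidence_vector: "y \<bullet> incidence_vector d = (\<Sum>e\<in>d. y $ e)"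
proof -
  have "y \<bullet> incidence_vector d = (\<Sum>e\<in>UNIV. if e \<in> d then y $ e else 0)"
    unfolding inner_vec_def incidence_vector_def by (auto intro: sum.cong)
  then show ?thesis by (simp add: sum.If_cases)
qed

lemma sum_incidence_vector: "(\<Sum>e\<in>F. incidence_vector d $ e) = real (card (d \<inter> F))"
  unfolding incidence_vector_def by (simp add: sum.If_cases Int_commute)

lemma k_connected_3_crossing_connected:
  assumes "k_connected 3 V E" "X \<subseteq> V" "card X < 3"
  shows "crossing_connected E (V - X)"
  using assms unfolding k_connected_def graph_connected_iff_crossing_connected by blast

text \<open>A chord \<open>{a, b}\<close> would make the cut of \<open>{a, b}\<close> a bond with four edges on the cycle.\<close>

lemma noninterleaved_cycle_chordless:
  assumes "simple_graph V E" "k_connected 3 V E" "is_cycle V E C" "\<not> interleaved V E C"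
    and "{a, b} \<in> E" "a \<in> set C" "b \<in> set C"
  shows "{a, b} \<in> cycle_edges C"
proof (rule ccontr)
  assume no: "{a, b} \<notin> cycle_edges C"
  have ab: "a \<in> V" "b \<in> V" "a \<noteq> b"
    using assms(1,5) unfolding simple_graph_def by fastforce+
  have "crossing_connected E (V - {a, b})"
    using assms(2) ab by (intro k_connected_3_crossing_connected) auto
  moreover have "crossing_connected E {a, b}"
    using crossing_connected_insert[OF crossing_connected_singleton[of E b], of b a] assms(5)
    by (simp add: insert_commute)
  ultimately have "is_bond V E (cut E {a, b})"
    using ab by (intro is_bond_cut) auto
  then have le: "card (cut E {a, b} \<inter> cycle_edges C) \<le> 2"
    using card_bond_cycle_le_2 assms by metis
  have C: "cycle_edges C \<subseteq> E" using assms(3) unfolding is_cycle_def by auto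
  have edge: "{u, x} \<in> cut E {a, b} \<inter> cycle_edges C"
    if "{u, x} \<in> cycle_edges C" "u = a \<or> u = b" "x \<noteq> u" for u x
  proof -
    have "x \<noteq> a" "x \<noteq> b" using that no by (auto simp: insert_commute)
    then have "{u, x} \<inter> {a, b} = {u}" using that by auto
    then show ?thesis using that C unfolding cut_def by auto
  qed
  obtain s t where st: "s \<noteq> t" "s \<noteq> a" "t \<noteq> a" "{a, s} \<in> cycle_edges C" "{a, t} \<in> cycle_edges C"
    using cycle_neighbours[OF assms(3,6)] by metis
  obtain p where p: "p \<noteq> b" "{b, p} \<in> cycle_edges C"
    using cycle_neighbours[OF assms(3,7)] by metis
  \<comment> \<open>Three of the four edges already exceed the bound.\<close>
  have "{{a, s}, {a, t}, {b, p}} \<subseteq> cut E {a, b} \<inter> cycle_edges C"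
    using edge st p by auto
  then have "card {{a, s}, {a, t}, {b, p}} \<le> 2"
    using le card_mono[of "cut E {a, b} \<inter> cycle_edges C"] by (meson finite le_trans)
  moreover have "p \<noteq> a" using p no by (auto simp: insert_commute)
  then have "{a, s} \<noteq> {a, t}" "{a, s} \<noteq> {b, p}" "{a, t} \<noteq> {b, p}"
    using st ab by (auto simp: doubleton_eq_iff)
  ultimately show False by simp
qed

text \<open>Equivalently, the incidence vectors of the tight bonds span R^E. \<open>supp\<close>
  places \<open>y\<close> in R^E; no bond constrains the coordinates outside
  \<open>E\<close>.\<close>

lemma orthogonal_to_tight_bonds_eq_0:
  fixes V :: "'v::finite set" and y :: "real ^ 'v set"
  assumes G: "simple_graph V E" "k_connected 3 V E" "is_cycle V E C" "\<not> interleaved V E C"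
    and supp: "\<And>e. e \<notin> E \<Longrightarrow> y $ e = 0"
    and orth: "\<And>d. is_bond V E d \<Longrightarrow> card (d \<inter> cycle_edges C) = 2 \<Longrightarrow> (\<Sum>e\<in>d. y $ e) = 0"
  shows "y = 0"
proof -
  interpret tight_weight V E C "\<lambda>a b. y $ {a, b}"
  proof
    show "crossing_connected E (V - X)" if "X \<subseteq> V" "card X < 3" for X
      using k_connected_3_crossing_connected G(2) that by metis
    show "is_cycle V E C" by fact
    show "{a, b} \<in> cycle_edges C" if "{a, b} \<in> E" "a \<in> set C" "b \<in> set C" for a b
      using noninterleaved_cycle_chordless G that by metis
    show "y $ {a, b} = y $ {b, a}" for a b by (simp add: insert_commute)
    show "y $ {a, b} = 0" if "{a, b} \<notin> E" for a b using supp that by simp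
    show "a \<in> V \<and> b \<in> V \<and> a \<noteq> b" if "{a, b} \<in> E" for a b
      using G(1) that unfolding simple_graph_def by fastforce
    show "(\<Sum>a\<in>T. \<Sum>b\<in>V - T. y $ {a, b}) = 0"
      if "T \<subseteq> V" "crossing_connected E T" "crossing_connected E (V - T)"
        "t \<in> set C" "t \<in> T" "s \<in> set C" "s \<notin> T" for T s t
    proof -
      have "is_bond V E (cut E T)" using that is_bond_cut by metis
      then have "(\<Sum>e\<in>cut E T. y $ e) = 0"
        using orth card_bond_cycle_eq_2[OF G(3,4)] that by metis
      then show ?thesis using sum_cut[OF G(1) \<open>T \<subseteq> V\<close>, of "\<lambda>e. y $ e"] supp by simp
    qed
  qed
  show ?thesis
  proof (rule vec_eq_iff[THEN iffD2], rule allI)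
    fix e
    show "y $ e = 0 $ e"
    proof (cases "e \<in> E")
      case True
      then obtain a b where "e = {a, b}"
        using G(1) unfolding simple_graph_def card_2_iff by blast
      then show ?thesis using weight_zero[of a b] by simp
    qed (simp add: supp)
  qed
qed

section \<open>The face and its dimension\<close>

theorem theorem6p5:
  fixes V :: "'v::finite set" and E :: "'v set set" and C :: "'v list"
  assumes "simple_graph V E"
    and "k_connected 3 V E"
    and "is_cycle V E C"
    and "\<not> interleaved V E C"
  shows "defines_facet (\<lambda>x. \<Sum>e\<in>cycle_edges C. x $ e) 2 (bond_polytope V E)"
proof -
  let ?c = "incidence_vector (cycle_edges C) :: real ^ 'v set"
  let ?l = "\<lambda>x :: real ^ 'v set. \<Sum>e\<in>cycle_edges C. x $ e"
  define P where "P = bond_polytope V E"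
  define F where "F = {x \<in> P. ?l x = 2}"
  let ?B = "{incidence_vector d | d. is_bond V E d}"
  have l: "?l x = ?c \<bullet> x" for x by (simp add: inner_incidence_vector inner_commute)
  have lin: "linear ?l" unfolding l by (intro bounded_linear.linear bounded_linear_inner_right)
  have conv: "convex P" unfolding P_def bond_polytope_def by simp
  have bondP: "incidence_vector d \<in> P" if "is_bond V E d" for d
    unfolding P_def bond_polytope_def using that by (auto intro: hull_inc)
  have "P \<subseteq> {x. ?c \<bullet> x \<le> 2}"
    unfolding P_def bond_polytope_def
  proof (rule hull_minimal)
    show "?B \<subseteq> {x. ?c \<bullet> x \<le> 2}"
      using card_bond_cycle_le_2[OF assms(3,4)]
      by (auto simp: l[symmetric] sum_incidence_vector)
  qed (rule convex_halfspace_le)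
  then have le: "?c \<bullet> x \<le> 2" if "x \<in> P" for x using that by auto
  have F: "F = P \<inter> {x. ?c \<bullet> x = 2}" unfolding F_def l by auto
  have tightF: "incidence_vector d \<in> F" if "is_bond V E d" "card (d \<inter> cycle_edges C) = 2" for d
    using that bondP unfolding F_def by (simp add: sum_incidence_vector)
  have face: "F face_of P"
    unfolding F using conv le by (rule face_of_Int_supporting_hyperplane_le)
  have conn: "crossing_connected E (V - X)" if "X \<subseteq> V" "card X < 3" for X
    using k_connected_3_crossing_connected assms(2) that by metis
  \<comment> \<open>The star of a single cycle vertex is a tight bond.\<close>
  have "F \<noteq> {}"
  proof -
    have "length C \<ge> 3" "set C \<subseteq> V" using assms(3) unfolding is_cycle_def by auto
    then have u: "C ! 0 \<in> set C" by (intro nth_mem) auto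
    then obtain s where "s \<in> set C" "s \<noteq> C ! 0"
      using cycle_neighbours[OF assms(3)] by metis
    moreover have "is_bond V E (cut E {C ! 0})"
      using conn[of "{C ! 0}"] u \<open>set C \<subseteq> V\<close> by (intro is_bond_cut) auto
    ultimately show ?thesis
      using tightF card_bond_cycle_eq_2[OF assms(3,4)] u by blast
  qed
  \<comment> \<open>\<open>R\<close> is R^E inside the ambient space.\<close>
  define R where "R = {x :: real ^ 'v set. \<forall>e. e \<notin> E \<longrightarrow> x $ e = 0}"
  have subR: "subspace R" unfolding R_def subspace_def by auto
  have "P \<subseteq> R"
    unfolding P_def bond_polytope_def
  proof (rule hull_minimal)
    show "?B \<subseteq> R"
      unfolding R_def is_bond_def cut_def incidence_vector_def by auto
  qed (rule subspace_imp_convex[OF subR])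
  have "P \<subseteq> span F"
  proof
    fix x assume "x \<in> P"
    \<comment> \<open>The part \<open>w\<close> of \<open>x\<close> orthogonal to
      \<open>span F\<close> lies in R^E and is orthogonal to all tight bonds, hence zero.\<close>
    obtain z w where zw: "z \<in> span F" "\<And>v. v \<in> span F \<Longrightarrow> orthogonal w v" "x = z + w"
      using orthogonal_subspace_decomp_exists[of F x] by metis
    have "F \<subseteq> R" using \<open>P \<subseteq> R\<close> unfolding F_def by auto
    then have "z \<in> R" using zw(1) subR span_minimal by blast
    then have "w \<in> R"
      using zw(3) \<open>x \<in> P\<close> \<open>P \<subseteq> R\<close> subR subspace_diff[of R x z] by auto
    have "w = 0"
    proof (rule orthogonal_to_tight_bonds_eq_0[OF assms])
      show "w $ e = 0" if "e \<notin> E" for e using \<open>w \<in> R\<close> that unfolding R_def by auto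
      show "(\<Sum>e\<in>d. w $ e) = 0" if "is_bond V E d" "card (d \<inter> cycle_edges C) = 2" for d
        using zw(2)[OF span_base[OF tightF[OF that]]]
        by (simp add: orthogonal_def inner_incidence_vector)
    qed
    then show "x \<in> span F" using zw by simp
  qed
  then have "span F = span P"
    unfolding F_def by (intro antisym span_mono span_minimal) auto
  then have dim: "dim F = dim P" by (metis dim_span)
  \<comment> \<open>The empty cut puts 0 into \<open>P\<close>, so the affine and linear dimensions
    of \<open>P\<close> agree.\<close>
  have "is_bond V E (cut E {})" using conn[of "{}"] by (intro is_bond_cut) auto
  moreover have "incidence_vector (cut E {}) = 0"
    unfolding cut_def incidence_vector_def by (simp add: vec_eq_iff)
  ultimately have "0 \<in> P" using bondP by metis
  \<comment> \<open>As the right-hand side 2 is nonzero, \<open>affine hull F\<close> misses 0; so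
    \<open>aff_dim F\<close> is one less than \<open>dim F\<close>, which equals
    \<open>dim P\<close>.\<close>
  have "affine hull F \<subseteq> {x. ?c \<bullet> x = 2}"
    unfolding F by (intro hull_minimal affine_hyperplane) auto
  then have "0 \<notin> affine hull F" by auto
  then have "aff_dim (insert 0 F) = aff_dim F + 1" by (simp add: aff_dim_insert)
  moreover have "aff_dim (insert 0 F) = dim F"
    using aff_dim_zero[of "insert 0 F"] by (metis dim_span hull_inc insertI1 span_insert_0)
  moreover have "aff_dim P = dim P" using \<open>0 \<in> P\<close> by (intro aff_dim_zero hull_inc)
  ultimately have "aff_dim F = aff_dim P - 1" using dim by simp
  then have "F facet_of P" using face \<open>F \<noteq> {}\<close> unfolding facet_of_def by simp
  then show ?thesis
    using lin le l unfolding defines_facet_def F_def P_def by simp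
qed

end
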